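(* Let $g$ be a polynomial of degree at least $2$. For every $\lambda>1$ there exist $\rho>0$, a positive integer $N$ and $\alpha>0$ such that the following holds. Suppose $z\in J(g)$ satisfies $$\chi_+(g,z)=\limsup_{n\to\infty}\frac1n\log|Dg^n(z)|>2\log\lambda.$$ Then there exists a set $H$ of positive integers with upper density at least $\alpha$ such that for every $n\in H$, letting $V_n$ denote the connected component of $g^{-n}(B(g^n(z),\rho))$ containing $z$, we have $V_n\subset B(z,\lambda^{-n}\rho)$ and the map $g^n:V_n\to B(g^n(z),\rho)$ is at most $N$-critical.
   Context: $J(g)$ is the Julia set of $g$. A map $g^n:V_n\to B(g^n(z),\rho)$ (with $V_n$ a component of the preimage of the disk) is called at most $N$-critical if the number of indices $j\in\{0,1,\dots,n-1\}$ such that $g^j(V_n)$ contains a critical point of $g$ is at most $N$. The upper density of $H\subset\mathbb{Z}^+$ is $\limsup_{m\to\infty}\#(H\cap\{1,\dots,m\})/m$. *)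

theory Defs
  imports "HOL-Analysis.Analysis" "HOL-Computational_Algebra.Polynomial"
begin

definition iter :: "complex poly \<Rightarrow> nat \<Rightarrow> complex \<Rightarrow> complex" where
  "iter g n = (poly g ^^ n)"

definition filled_julia :: "complex poly \<Rightarrow> complex set" where
  "filled_julia g = {z. bounded (range (\<lambda>n. iter g n z))}"

definition julia_set :: "complex poly \<Rightarrow> complex set" where
  "julia_set g = frontier (filled_julia g)"

definition lyap_term :: "complex poly \<Rightarrow> complex \<Rightarrow> nat \<Rightarrow> ereal" where
  "lyap_term g z n =
     (if deriv (iter g n) z = 0 then -\<infinity>
      else ereal (ln (cmod (deriv (iter g n) z)) / real n))"

definition upper_lyapunov :: "complex poly \<Rightarrow> complex \<Rightarrow> ereal" where
  "upper_lyapunov g z = limsup (lyap_term g z)"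

definition upper_density :: "nat set \<Rightarrow> ereal" where
  "upper_density H = limsup (\<lambda>m. ereal (real (card (H \<inter> {1..m})) / real m))"

definition crit_points :: "complex poly \<Rightarrow> complex set" where
  "crit_points g = {c. poly (pderiv g) c = 0}"

definition pullback_comp :: "complex poly \<Rightarrow> nat \<Rightarrow> real \<Rightarrow> complex \<Rightarrow> complex set" where
  "pullback_comp g n \<rho> z =
     connected_component_set (iter g n -` ball (iter g n z) \<rho>) z"

definition at_most_critical :: "complex poly \<Rightarrow> nat \<Rightarrow> complex set \<Rightarrow> nat \<Rightarrow> bool" where
  "at_most_critical g n V N \<longleftrightarrow>
     card {j. j < n \<and> iter g j ` V \<inter> crit_points g \<noteq> {}} \<le> N"

end

(* Put a_j = log |g'(g^j z)|. These numbers are bounded above on J(g), and for infinitely many m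
   their average over j < m is at least 2b, where b = log lam. Two counting arguments then give a
   positive proportion of times n <= m such that
   (1) |D g^(n-j) (g^j z)| >= exp (c (n - j)) for all j < n, with c = 3b/2 (Pliss lemma);
   (2) |g'(g^j z)|^2 >= exp (- b (n - j)) for all but at most N indices j < n.
   For (2) one uses that the sum of the negative parts of the a_j is O(m), so that no recurrence
   estimate for critical points is needed.

   At such a time, pull the disk of radius rho back along the orbit. A pullback step always divides
   the radius by |g'|, up to a factor C depending only on deg g. If the radius r is small compared with
   |g'|^2, the factor is 1 + O(r / |g'|^2) and the pullback contains no critical point. By (1), (2)
   and the smallness of rho, this better estimate holds outside the N exceptional steps with
   summable errors, because c > b. The pullback at time j thus has radius at most
   const * C^N * rho * exp (- c (n - j)), and as c > log lam the constant is absorbed for n large. *)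

theory Submission
  imports Defs "HOL-Computational_Algebra.Fundamental_Theorem_Algebra"
begin

section \<open>Pulling a disk back through one polynomial step\<close>

lemma connected_contains_norm:
  fixes W :: "complex set"
  assumes "connected W" "w \<in> W" "u \<in> W" "0 \<le> t" "t \<le> cmod (u - w)"
  obtains u' where "u' \<in> W" "cmod (u' - w) = t"
proof -
  have "connected ((\<lambda>x. cmod (x - w)) ` W)"
    by (intro connected_continuous_image continuous_intros assms)
  moreover have "0 \<in> (\<lambda>x. cmod (x - w)) ` W" "cmod (u - w) \<in> (\<lambda>x. cmod (x - w)) ` W"
    using assms(2,3) by force+
  ultimately have "t \<in> (\<lambda>x. cmod (x - w)) ` W"
    using assms(4,5) connected_contains_Icc[of "(\<lambda>x. cmod (x - w)) ` W" 0 "cmod (u - w)"] by auto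
  then show ?thesis using that by auto
qed

lemma connected_subset_ball:
  fixes W :: "complex set"
  assumes "connected W" "w \<in> W" "0 \<le> t" "\<And>u. u \<in> W \<Longrightarrow> cmod (u - w) \<noteq> t"
  shows "W \<subseteq> ball w t"
proof
  fix u assume "u \<in> W"
  then have "\<not> t \<le> cmod (u - w)"
    using connected_contains_norm[OF assms(1,2) _ assms(3)] assms(4) by metis
  then show "u \<in> ball w t" by (simp add: dist_norm norm_minus_commute)
qed

text \<open>Pigeonhole: the grid has \<open>Suc e\<close> points with spacing
  \<open>h = s / Suc e\<close>, and each of the \<open>e\<close> values \<open>x i\<close> is closer
  than \<open>h / 2\<close> to at most one of them.\<close>

lemma grid_avoids_points:
  fixes x :: "nat \<Rightarrow> real"
  assumes "s > 0"
  shows "\<exists>k\<le>e. \<forall>i<e. s / (2 * real (Suc e)) \<le> \<bar>s * real (Suc k) / real (Suc e) - x i\<bar>"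
proof (rule ccontr)
  define h where "h = s / real (Suc e)"
  have h: "h > 0" using assms by (simp add: h_def)
  have eqs: "s / (2 * real (Suc e)) = h / 2" "s * real (Suc k) / real (Suc e) = h * real (Suc k)" for k
    by (simp_all add: h_def field_simps)
  assume "\<not> ?thesis"
  then have "\<forall>k\<in>{..e}. \<exists>i<e. \<bar>h * real (Suc k) - x i\<bar> < h / 2"
    unfolding eqs by (meson atMost_iff not_le)
  then obtain f where f: "\<And>k. k \<le> e \<Longrightarrow> f k < e \<and> \<bar>h * real (Suc k) - x (f k)\<bar> < h / 2"
    by (metis atMost_iff)
  have "\<not> inj_on f {..e}"
  proof
    assume "inj_on f {..e}"
    then have "card {..e} \<le> card {..<e}" using f by (intro card_inj_on_le) auto
    then show False by simp
  qed
  then obtain k l where kl: "k \<le> e" "l \<le> e" "k < l" "f k = f l"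
    unfolding inj_on_def by (metis atMost_iff nat_neq_iff)
  have "h * real (Suc l) - h * real (Suc k) < h"
    using f[OF kl(1)] f[OF kl(2)] unfolding kl(4) by linarith
  moreover have "h * 1 \<le> h * (real (Suc l) - real (Suc k))"
    using kl(3) h by (intro mult_left_mono) auto
  ultimately show False by (simp add: algebra_simps)
qed

text \<open>The polynomial may be small at a given point, but not on a whole well-chosen circle.
  Take the radius from a grid that avoids the distances from \<open>w\<close> to the roots, and
  compare root by root. A root within \<open>2 * s\<close> of \<open>w\<close> stays at distance at
  least \<open>s / (2 * Suc e)\<close> from the circle; for a farther root the distances from
  \<open>w\<close> and from a point of the circle are comparable.\<close>

lemma poly_circle_lower_bound:
  fixes q :: "complex poly"
  assumes "s > 0"
  obtains t where "s / real (Suc (degree q)) \<le> t" "t \<le> s"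
    "\<And>u. cmod (u - w) = t \<Longrightarrow> cmod (poly q w) \<le> (4 * real (Suc (degree q))) ^ degree q * cmod (poly q u)"
proof -
  define e where "e = degree q"
  obtain \<zeta> where \<zeta>: "smult (lead_coeff q) (\<Prod>i<e. [:- \<zeta> i, 1:]) = q"
    unfolding e_def using complex_poly_decompose' by blast
  have qeq: "cmod (poly q x) = cmod (lead_coeff q) * (\<Prod>i<e. cmod (x - \<zeta> i))" for x
    by (subst \<zeta>[symmetric], simp add: poly_prod norm_mult prod_norm)
  obtain k where k: "k \<le> e"
    "\<And>i. i < e \<Longrightarrow> s / (2 * real (Suc e)) \<le> \<bar>s * real (Suc k) / real (Suc e) - cmod (w - \<zeta> i)\<bar>"
    using grid_avoids_points[OF assms, of e "\<lambda>i. cmod (w - \<zeta> i)"] by blast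
  define t where "t = s * real (Suc k) / real (Suc e)"
  have t: "s / real (Suc e) \<le> t" "t \<le> s"
    using k(1) assms by (auto simp: t_def field_simps)
  have "cmod (poly q w) \<le> (4 * real (Suc e)) ^ e * cmod (poly q u)" if u: "cmod (u - w) = t" for u
  proof -
    have fac: "cmod (w - \<zeta> i) \<le> 4 * real (Suc e) * cmod (u - \<zeta> i)" if i: "i < e" for i
    proof -
      have tri: "\<bar>t - cmod (w - \<zeta> i)\<bar> \<le> cmod (u - \<zeta> i)"
        using u norm_triangle_ineq3[of "u - w" "\<zeta> i - w"] by (simp add: norm_minus_commute)
      show ?thesis
      proof (cases "cmod (w - \<zeta> i) \<le> 2 * s")
        case True
        have "s / (2 * real (Suc e)) \<le> cmod (u - \<zeta> i)" using tri k(2)[OF i] by (simp add: t_def)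
        then have "2 * s \<le> 4 * real (Suc e) * cmod (u - \<zeta> i)" by (simp add: field_simps)
        with True show ?thesis by linarith
      next
        case False
        then have "cmod (w - \<zeta> i) \<le> 4 * cmod (u - \<zeta> i)" using tri t by linarith
        also have "\<dots> \<le> 4 * real (Suc e) * cmod (u - \<zeta> i)"
          by (intro mult_right_mono) auto
        finally show ?thesis .
      qed
    qed
    have "(\<Prod>i<e. cmod (w - \<zeta> i)) \<le> (\<Prod>i<e. 4 * real (Suc e) * cmod (u - \<zeta> i))"
      by (intro prod_mono) (use fac in auto)
    also have "\<dots> = (4 * real (Suc e)) ^ e * (\<Prod>i<e. cmod (u - \<zeta> i))"
      by (simp add: prod.distrib)
    finally have "cmod (lead_coeff q) * (\<Prod>i<e. cmod (w - \<zeta> i))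
        \<le> cmod (lead_coeff q) * ((4 * real (Suc e)) ^ e * (\<Prod>i<e. cmod (u - \<zeta> i)))"
      by (intro mult_left_mono) auto
    then show ?thesis unfolding qeq by (simp only: mult_ac)
  qed
  with t show ?thesis using that unfolding e_def by blast
qed

text \<open>The loss compared with a univalent pullback is a factor depending only on the degree, however close
  to a critical point \<open>w\<close> lies.\<close>

lemma connected_pullback_bound:
  fixes g :: "complex poly"
  assumes deg: "degree g > 0" and W: "connected W" "w \<in> W"
    and sub: "poly g ` W \<subseteq> ball (poly g w) r" and nz: "poly (pderiv g) w \<noteq> 0"
  shows "W \<subseteq> ball w ((4 * real (degree g)) ^ degree g * r / cmod (poly (pderiv g) w))"
proof
  fix u assume u: "u \<in> W"
  define d where "d = degree g"
  define s where "s = cmod (u - w)"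
  have r: "r > 0" using sub W(2) by force
  show "u \<in> ball w ((4 * real (degree g)) ^ degree g * r / cmod (poly (pderiv g) w))"
  proof (cases "s = 0")
    case True
    then show ?thesis using r deg nz by (simp add: s_def)
  next
    case False
    then have s: "s > 0" by (simp add: s_def)
    \<comment> \<open>Dividing g - g(w) by X - w turns the derivative at \<open>w\<close> into the
      value \<open>q\<close>(\<open>w\<close>), of a polynomial of degree
      \<open>d - 1\<close>.\<close>
    define p where "p = g - [:poly g w:]"
    have "poly p w = 0" by (simp add: p_def)
    then obtain q where q: "p = [:- w, 1:] * q" by (auto simp: poly_eq_0_iff_dvd)
    have degp: "degree p = d"
      unfolding p_def d_def using deg degree_add_eq_left[of "- [:poly g w:]" g] by (simp del: minus_pCons)
    have "q \<noteq> 0" using degp deg q by (auto simp: d_def)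
    then have d: "d = Suc (degree q)" using degp unfolding q by (subst (asm) degree_mult_eq) auto
    have "poly (pderiv p) w = poly q w" unfolding q pderiv_mult by (simp add: pderiv_pCons)
    moreover have "pderiv p = pderiv g" by (simp add: p_def pderiv_diff pderiv_pCons)
    ultimately have qw: "poly q w = poly (pderiv g) w" by simp
    obtain t where t: "s / real d \<le> t" "t \<le> s"
      "\<And>u. cmod (u - w) = t \<Longrightarrow> cmod (poly q w) \<le> (4 * real d) ^ degree q * cmod (poly q u)"
      using poly_circle_lower_bound[OF s, of q w] d by metis
    have t0: "t > 0" using t(1) s d by (smt (verit) divide_pos_pos of_nat_0_less_iff zero_less_Suc)
    \<comment> \<open>At \<open>u\<close> itself \<open>q\<close> may be tiny. Connectedness
      replaces \<open>u\<close> by a point of \<open>W\<close> on the good circle, where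
      \<open>q\<close> is bounded below; since \<open>s \<le> d * t\<close>, the distance shrinks by
      at most the factor \<open>d\<close>.\<close>
    obtain u' where u': "u' \<in> W" "cmod (u' - w) = t"
      using connected_contains_norm[OF W u] t(2) t0 unfolding s_def by (metis less_imp_le)
    have "cmod (poly g u' - poly g w) < r"
      using sub u'(1) by (auto simp: dist_norm norm_minus_commute)
    moreover have "poly g u' - poly g w = (u' - w) * poly q u'"
      using arg_cong[OF q, of "\<lambda>p. poly p u'"] by (simp add: p_def algebra_simps)
    ultimately have less: "t * cmod (poly q u') < r" by (simp add: norm_mult u'(2))
    have "s * cmod (poly (pderiv g) w) \<le> (real d * t) * ((4 * real d) ^ degree q * cmod (poly q u'))"
      using t(1) t(3)[OF u'(2)] d s t0 unfolding qw by (intro mult_mono) (auto simp: field_simps)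
    also have "\<dots> = (real d * (4 * real d) ^ degree q) * (t * cmod (poly q u'))" by simp
    also have "\<dots> < (real d * (4 * real d) ^ degree q) * r"
      using less d by (intro mult_strict_left_mono) auto
    also have "\<dots> \<le> (4 * real d) ^ d * r" using r d by (simp add: mult_right_mono)
    finally have "s < (4 * real d) ^ d * r / cmod (poly (pderiv g) w)" using nz by (simp add: field_simps)
    then show ?thesis by (simp add: s_def d_def dist_norm norm_minus_commute)
  qed
qed

lemma poly_taylor_bound:
  fixes g :: "complex poly"
  obtains M where "M \<ge> 1"
    "\<And>w. cmod w \<le> R \<Longrightarrow> cmod (poly (pderiv g) w) \<le> M"
    "\<And>w u. \<lbrakk>cmod w \<le> R; cmod u \<le> R\<rbrakk> \<Longrightarrow>
      cmod (poly (pderiv g) u - poly (pderiv g) w) \<le> M * cmod (u - w)"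
    "\<And>w u. \<lbrakk>cmod w \<le> R; cmod u \<le> R\<rbrakk> \<Longrightarrow>
      cmod (poly g u - poly g w - poly (pderiv g) w * (u - w)) \<le> M * cmod (u - w) ^ 2"
proof -
  have bd: "\<exists>B. \<forall>w\<in>cball 0 R. cmod (poly p w) \<le> B" for p :: "complex poly"
  proof -
    have "compact (poly p ` cball 0 R)" by (intro compact_continuous_image continuous_intros compact_cball)
    then show ?thesis using compact_imp_bounded bounded_iff by (metis imageI)
  qed
  obtain B1 where B1: "\<And>w. w \<in> cball 0 R \<Longrightarrow> cmod (poly (pderiv g) w) \<le> B1" using bd by metis
  obtain B2 where B2: "\<And>w. w \<in> cball 0 R \<Longrightarrow> cmod (poly (pderiv (pderiv g)) w) \<le> B2" using bd by metis
  define M where "M = max 1 (max B1 B2)"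
  have D: "(poly p has_field_derivative poly (pderiv p) x) (at x within S)" for p :: "complex poly" and x S
    by (rule has_field_derivative_at_within[OF poly_DERIV])
  have lip: "cmod (poly (pderiv g) u - poly (pderiv g) w) \<le> M * cmod (u - w)"
    if "cmod w \<le> R" "cmod u \<le> R" for w u
    using field_differentiable_bound[of "cball 0 R" "poly (pderiv g)" "poly (pderiv (pderiv g))" M u w]
      that B2 D by (force simp: M_def)
  have tay: "cmod (poly g u - poly g w - poly (pderiv g) w * (u - w)) \<le> M * cmod (u - w) ^ 2"
    if wu: "cmod w \<le> R" "cmod u \<le> R" for w u
  proof -
    \<comment> \<open>Mean value inequality for g(x) - g'(w) x on the segment: its derivative there
      is at most M |u - w|, by the Lipschitz bound.\<close>
    have "cmod ((poly g u - poly (pderiv g) w * u) - (poly g w - poly (pderiv g) w * w))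
        \<le> (M * cmod (u - w)) * cmod (u - w)"
    proof (rule field_differentiable_bound[of "closed_segment w u"
        "\<lambda>x. poly g x - poly (pderiv g) w * x" "\<lambda>x. poly (pderiv g) x - poly (pderiv g) w"])
      fix x assume x: "x \<in> closed_segment w u"
      have "closed_segment w u \<subseteq> cball 0 R" using wu by (intro closed_segment_subset) auto
      then have "cmod x \<le> R" using x by auto
      then have "cmod (poly (pderiv g) x - poly (pderiv g) w) \<le> M * cmod (x - w)" using lip wu by blast
      also have "\<dots> \<le> M * cmod (u - w)"
        using segment_bound(1)[OF x] by (intro mult_left_mono) (auto simp: M_def)
      finally show "cmod (poly (pderiv g) x - poly (pderiv g) w) \<le> M * cmod (u - w)" .
      show "((\<lambda>x. poly g x - poly (pderiv g) w * x) has_field_derivative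
          poly (pderiv g) x - poly (pderiv g) w) (at x within closed_segment w u)"
        by (auto intro!: derivative_eq_intros D)
    qed auto
    then show ?thesis by (simp add: algebra_simps power2_eq_square)
  qed
  show ?thesis
    by (rule that[of M]) (use B1 lip tay in \<open>force simp: M_def\<close>)+
qed

text \<open>On the circle of radius t = (1 + \<epsilon>) r / D the Taylor estimate gives |g(u) -
  g(w)| \<ge> D t - M t^2 \<ge> r, because M t^2 \<le> \<epsilon> r. So the connected set
  \<open>W\<close> cannot cross this circle. Inside it g' varies by at most M t \<le> \<epsilon> D /
  2 < D and cannot vanish. The condition 2 r \<le> D makes t \<le> 1, where the local estimates are
  available.\<close>

lemma connected_pullback_bound_noncritical:
  fixes g :: "complex poly"
  assumes W: "connected W" "w \<in> W" and sub: "poly g ` W \<subseteq> ball (poly g w) r"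
    and D: "D = cmod (poly (pderiv g) w)" "D > 0"
    and M: "M > 0"
    and lip: "\<And>u. cmod (u - w) \<le> 1 \<Longrightarrow> cmod (poly (pderiv g) u - poly (pderiv g) w) \<le> M * cmod (u - w)"
    and tay: "\<And>u. cmod (u - w) \<le> 1 \<Longrightarrow>
      cmod (poly g u - poly g w - poly (pderiv g) w * (u - w)) \<le> M * cmod (u - w) ^ 2"
    and \<epsilon>: "4 * M * r \<le> \<epsilon> * D\<^sup>2" "\<epsilon> \<le> 1" and r: "2 * r \<le> D"
  shows "W \<subseteq> ball w ((1 + \<epsilon>) * r / D)" and "W \<inter> crit_points g = {}"
proof -
  have r0: "r > 0" using sub W(2) by force
  have "0 < 4 * M * r" using M r0 by simp
  then have e0: "\<epsilon> > 0" using \<epsilon>(1) D(2) by (smt (verit) mult_nonpos_nonneg zero_le_power2)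
  define t where "t = (1 + \<epsilon>) * r / D"
  have t0: "t > 0" using e0 r0 D by (simp add: t_def)
  have tr: "t * D = (1 + \<epsilon>) * r" using D(2) by (simp add: t_def)
  have t2: "t * D \<le> 2 * r" unfolding tr using \<epsilon>(2) r0 by (intro mult_right_mono) auto
  then have "t * D \<le> 1 * D" using r by linarith
  then have t1: "t \<le> 1" using D(2) by (metis mult_right_le_imp_le)
  have "2 * (M * t) * D \<le> \<epsilon> * D * D"
  proof -
    have "2 * M * (t * D) \<le> 2 * M * (2 * r)" using t2 M by (intro mult_left_mono) auto
    then show ?thesis using \<epsilon>(1) by (simp add: power2_eq_square algebra_simps)
  qed
  then have Mt: "2 * (M * t) \<le> \<epsilon> * D" using D(2) by (metis mult_right_le_imp_le)
  have ball: "W \<subseteq> ball w t"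
  proof (rule connected_subset_ball[OF W])
    show "0 \<le> t" using t0 by simp
    fix u assume u: "u \<in> W"
    show "cmod (u - w) \<noteq> t"
    proof
      assume ut: "cmod (u - w) = t"
      have "cmod (poly g u - poly g w) < r" using sub u by (auto simp: dist_norm norm_minus_commute)
      moreover have "D * t - M * t\<^sup>2 \<le> cmod (poly g u - poly g w)"
        using tay[of u] norm_triangle_ineq2[of "poly (pderiv g) w * (u - w)" "poly (pderiv g) w * (u - w) - (poly g u - poly g w)"] ut t1
        by (simp add: norm_mult D(1) norm_minus_commute)
      ultimately have lt: "D * t - (M * t) * t < r" by (simp add: power2_eq_square mult.assoc)
      have "(M * t) * t \<le> (\<epsilon> * D / 2) * t" using Mt t0 by (intro mult_right_mono) auto
      also have "\<dots> = (\<epsilon> / 2) * ((1 + \<epsilon>) * r)" unfolding tr[symmetric] by simp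
      also have "\<dots> \<le> (\<epsilon> / 2) * (2 * r)" using e0 t2 tr by (intro mult_left_mono) auto
      finally have "(M * t) * t \<le> \<epsilon> * r" by simp
      moreover have "D * t = r + \<epsilon> * r" using tr by (simp add: algebra_simps)
      ultimately show False using lt by linarith
    qed
  qed
  then show "W \<subseteq> ball w ((1 + \<epsilon>) * r / D)" by (simp add: t_def)
  show "W \<inter> crit_points g = {}"
  proof (rule ccontr)
    assume "W \<inter> crit_points g \<noteq> {}"
    then obtain u where u: "u \<in> W" "poly (pderiv g) u = 0" by (auto simp: crit_points_def)
    have ut: "cmod (u - w) < t" using ball u(1) by (auto simp: dist_norm norm_minus_commute)
    then have "D \<le> M * cmod (u - w)" using lip[of u] t1 u(2) by (simp add: D(1))
    also have "\<dots> \<le> M * t" using ut M by (intro mult_left_mono) auto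
    also have "\<dots> \<le> \<epsilon> * D / 2" using Mt by simp
    also have "\<dots> < D" using \<epsilon>(2) D(2) by (smt (verit) mult_right_le_one_le e0 field_sum_of_halves mult.commute)
    finally show False by simp
  qed
qed

section \<open>Counting good times\<close>

text \<open>With s(n) = a_0 + ... + a_(n-1) - c n, the times counted are those n with s(j) \<le>
  s(n) for all j < n. The running maximum of s starts at 0, can grow only at such times, and then
  grows by at most A - c. The induction therefore bounds s(j) for all j \<le> m at once.\<close>

lemma pliss_lemma:
  fixes a :: "nat \<Rightarrow> real"
  assumes a: "\<And>j. a j \<le> A" and cA: "c < A"
  shows "sum a {..<m} - c * real m
    \<le> (A - c) * real (card ({n. \<forall>j<n. c * real (n - j) \<le> sum a {j..<n}} \<inter> {1..m}))"
proof -
  define s where "s n = sum a {..<n} - c * real n" for n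
  define P where "P = {n. \<forall>j<n. c * real (n - j) \<le> sum a {j..<n}}"
  have sdiff: "s n - s j = sum a {j..<n} - c * real (n - j)" if "j \<le> n" for j n
  proof -
    have "sum a {..<n} = sum a {..<j} + sum a {j..<n}"
      using that sum.atLeastLessThan_concat[of 0 j n a] by (simp add: atLeast0LessThan)
    then show ?thesis using that by (simp add: s_def of_nat_diff algebra_simps)
  qed
  have "\<forall>j\<le>m. s j \<le> (A - c) * real (card (P \<inter> {1..m}))"
  proof (induction m)
    case 0
    then show ?case by (simp add: s_def)
  next
    case (Suc m)
    have mono: "(A - c) * real (card (P \<inter> {1..m})) \<le> (A - c) * real (card (P \<inter> {1..Suc m}))"
      using cA by (intro mult_left_mono of_nat_mono card_mono) auto
    have "s (Suc m) \<le> (A - c) * real (card (P \<inter> {1..Suc m}))"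
    proof (cases "Suc m \<in> P")
      case True
      then have "P \<inter> {1..Suc m} = insert (Suc m) (P \<inter> {1..m})" by auto
      then have "card (P \<inter> {1..Suc m}) = Suc (card (P \<inter> {1..m}))" by simp
      moreover have "s (Suc m) \<le> s m + (A - c)" using a[of m] by (simp add: s_def algebra_simps)
      ultimately show ?thesis using Suc.IH by (force simp: algebra_simps)
    next
      case False
      then obtain j where j: "j < Suc m" "sum a {j..<Suc m} < c * real (Suc m - j)"
        by (auto simp: P_def not_le)
      then have "s (Suc m) < s j" using sdiff[of j "Suc m"] by simp
      moreover have "s j \<le> (A - c) * real (card (P \<inter> {1..m}))" using Suc.IH j(1) by simp
      ultimately show ?thesis using mono by linarith
    qed
    then show ?case using Suc.IH mono by (force simp: le_Suc_eq)
  qed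
  then show ?thesis by (simp add: s_def P_def)
qed

text \<open>For a_j = log |g'(g^j z)| these are the exceptional indices of time \<open>n\<close>,
  where |g'(g^j z)|^2 < exp (- b (n - j)). Seen from j, a strongly negative a_j casts a shadow over
  the next -2 a_j / b times.\<close>

definition shadow :: "(nat \<Rightarrow> real) \<Rightarrow> real \<Rightarrow> nat \<Rightarrow> nat set" where
  "shadow a b n = {j. j < n \<and> 2 * a j < - b * real (n - j)}"

lemma finite_shadow [simp]: "finite (shadow a b n)"
  by (rule finite_subset[of _ "{..<n}"]) (auto simp: shadow_def)

text \<open>Double counting of pairs (j, n): index j lies in the shadow of at most max 0 (-2 a_j /
  b) times. This is at most (2 / b) (A - a_j), a majorant whose sum over j is controlled by the
  hypothesis that the a_j have nonnegative sum.\<close>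

lemma sum_card_shadow:
  fixes a :: "nat \<Rightarrow> real"
  assumes a: "\<And>j. a j \<le> A" and A: "A \<ge> 0" and b: "b > 0" and s: "sum a {..<m} \<ge> 0"
  shows "(\<Sum>n=1..m. real (card (shadow a b n))) \<le> 2 * A / b * real m"
proof -
  have single: "real (card {n\<in>{1..m}. j \<in> shadow a b n}) \<le> 2 / b * (A - a j)" if "j < m" for j
  proof -
    define K where "K = nat \<lfloor>- 2 * a j / b\<rfloor>"
    have "{n\<in>{1..m}. j \<in> shadow a b n} \<subseteq> {j<..j + K}"
    proof
      fix n assume "n \<in> {n\<in>{1..m}. j \<in> shadow a b n}"
      then have n: "j < n" "2 * a j < - b * real (n - j)" by (auto simp: shadow_def)
      then have "real (n - j) \<le> - 2 * a j / b" using b by (simp add: field_simps)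
      then have "n - j \<le> K" unfolding K_def by (simp add: le_nat_floor)
      with n show "n \<in> {j<..j + K}" by auto
    qed
    then have "card {n\<in>{1..m}. j \<in> shadow a b n} \<le> card {j<..j + K}" by (intro card_mono) auto
    then have "real (card {n\<in>{1..m}. j \<in> shadow a b n}) \<le> real K" by simp
    also have "\<dots> \<le> max 0 (- 2 * a j / b)" unfolding K_def by linarith
    also have "\<dots> \<le> 2 / b * (A - a j)" using a[of j] A b by (auto simp: field_simps)
    finally show ?thesis .
  qed
  have "(\<Sum>n=1..m. real (card (shadow a b n))) = (\<Sum>n=1..m. \<Sum>j<m. if j \<in> shadow a b n then 1 else 0)"
  proof (rule sum.cong[OF refl])
    fix n assume "n \<in> {1..m}"
    then have "{..<m} \<inter> shadow a b n = shadow a b n" by (auto simp: shadow_def)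
    then show "real (card (shadow a b n)) = (\<Sum>j<m. if j \<in> shadow a b n then 1 else 0)"
      by (simp add: sum.If_cases Int_def)
  qed
  also have "\<dots> = (\<Sum>j<m. \<Sum>n=1..m. if j \<in> shadow a b n then 1 else 0)" by (rule sum.swap)
  also have "\<dots> = (\<Sum>j<m. real (card {n\<in>{1..m}. j \<in> shadow a b n}))"
    by (simp add: sum.If_cases Int_def)
  also have "\<dots> \<le> (\<Sum>j<m. 2 / b * (A - a j))" by (intro sum_mono) (use single in auto)
  also have "\<dots> = 2 / b * (A * real m - sum a {..<m})"
    by (simp only: sum_distrib_left[symmetric] sum_subtractf) simp
  also have "\<dots> \<le> 2 / b * (A * real m)" using s b by (intro mult_left_mono) auto
  finally show ?thesis by simp
qed

text \<open>The Pliss lemma supplies at least \<open>\<theta> * m\<close> times. By Markov's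
  inequality for the cardinality of the shadow, at most \<open>\<theta> / 2 * m\<close> times have
  more than \<open>N\<close> exceptional indices. Removing these and the times below
  \<open>n0\<close> leaves the claimed number.\<close>

lemma card_good_times:
  fixes a :: "nat \<Rightarrow> real"
  assumes a: "\<And>j. a j \<le> A" and b: "b > 0" "b < c" "c < 2 * b" and A: "2 * b \<le> A"
    and N: "4 * A * (A - c) \<le> b * (2 * b - c) * real N"
    and s: "sum a {..<m} \<ge> 2 * b * real m"
  shows "card ({n. n \<ge> n0 \<and> (\<forall>j<n. c * real (n - j) \<le> sum a {j..<n}) \<and> card (shadow a b n) \<le> N} \<inter> {1..m})
    \<ge> (2 * b - c) / (2 * (A - c)) * real m - real n0"
proof -
  define \<theta> where "\<theta> = (2 * b - c) / (A - c)"
  define P where "P = {n. \<forall>j<n. c * real (n - j) \<le> sum a {j..<n}} \<inter> {1..m}"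
  define X where "X = {n\<in>{1..m}. N < card (shadow a b n)}"
  define G where "G = {n. n \<ge> n0 \<and> (\<forall>j<n. c * real (n - j) \<le> sum a {j..<n}) \<and> card (shadow a b n) \<le> N} \<inter> {1..m}"
  have Ac: "A - c > 0" using b A by linarith
  have th: "\<theta> > 0" using Ac b by (simp add: \<theta>_def)
  have fin: "finite P" "finite X" "finite G" by (auto simp: P_def X_def G_def)
  have "(2 * b - c) * real m \<le> (A - c) * real (card P)"
    using pliss_lemma[of a A c m, OF a] Ac s unfolding P_def by (simp add: algebra_simps)
  then have cP: "\<theta> * real m \<le> real (card P)" using Ac by (simp add: \<theta>_def field_simps)
  have "real N * real (card X) = (\<Sum>n\<in>X. real N)" by simp
  also have "\<dots> \<le> (\<Sum>n\<in>X. real (card (shadow a b n)))" by (intro sum_mono) (auto simp: X_def)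
  also have "\<dots> \<le> (\<Sum>n=1..m. real (card (shadow a b n)))" by (intro sum_mono2) (auto simp: X_def)
  also have "\<dots> \<le> 2 * A / b * real m"
    using b A s by (intro sum_card_shadow a) (auto intro: order_trans[rotated])
  finally have NX: "real N * real (card X) \<le> 2 * A / b * real m" .
  \<comment> \<open>The hypothesis on \<open>N\<close> is this inequality with denominators
    cleared.\<close>
  have NA: "2 * A / b \<le> \<theta> / 2 * real N"
    using N Ac b(1) by (simp add: \<theta>_def field_simps)
  have "0 < 2 * A / b" using b A by simp
  then have N0: "real N > 0" using NA th by (smt (verit) zero_less_mult_pos divide_pos_pos)
  have "real N * real (card X) \<le> (\<theta> / 2 * real N) * real m"
    using NX mult_right_mono[OF NA, of "real m"] by linarith
  then have "real N * real (card X) \<le> real N * (\<theta> / 2 * real m)" by (simp add: algebra_simps)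
  then have cX: "real (card X) \<le> \<theta> / 2 * real m" using N0 by (metis mult_left_le_imp_le)
  have "P \<subseteq> G \<union> X \<union> {..<n0}" by (auto simp: P_def G_def X_def)
  then have "card P \<le> card (G \<union> X \<union> {..<n0})" using fin by (intro card_mono) auto
  also have "\<dots> \<le> card G + card X + n0"
    by (metis card_Un_le card_lessThan add_le_mono1 order_trans)
  finally have "real (card P) \<le> real (card G) + real (card X) + real n0" by linarith
  moreover have "(2 * b - c) / (2 * (A - c)) * real m = \<theta> * real m / 2" by (simp add: \<theta>_def)
  ultimately have "real (card G) \<ge> (2 * b - c) / (2 * (A - c)) * real m - real n0" using cP cX by linarith
  then show ?thesis unfolding G_def .
qed

lemma upper_density_ge:
  assumes "\<exists>\<^sub>F m in sequentially. \<alpha> * real m \<le> real (card (H \<inter> {1..m}))"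
  shows "upper_density H \<ge> ereal \<alpha>"
proof (rule ccontr)
  assume "\<not> ?thesis"
  then have "limsup (\<lambda>m. ereal (real (card (H \<inter> {1..m})) / real m)) < ereal \<alpha>"
    by (simp add: upper_density_def)
  then have "\<forall>\<^sub>F m in sequentially. ereal (real (card (H \<inter> {1..m})) / real m) < ereal \<alpha>"
    by (rule Limsup_lessD)
  then have "\<forall>\<^sub>F m in sequentially. \<not> \<alpha> * real m \<le> real (card (H \<inter> {1..m}))"
    using eventually_gt_at_top[of 0] by eventually_elim (simp add: field_simps)
  with assms show False by (simp add: frequently_def)
qed

section \<open>Pulling back along an orbit\<close>

text \<open>Bounds the accumulated error of the nonexceptional steps uniformly in \<open>n\<close>
  and \<open>j\<close>, by 1 + x \<le> exp x and the geometric series.\<close>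

lemma prod_one_plus_geometric_le:
  fixes q :: real
  assumes "0 \<le> q" "q < 1"
  shows "(\<Prod>i\<in>{j..<n}. 1 + q ^ (n - i)) \<le> exp (1 / (1 - q))"
proof -
  have "(\<Prod>i\<in>{j..<n}. 1 + q ^ (n - i)) \<le> (\<Prod>i\<in>{j..<n}. exp (q ^ (n - i)))"
    using assms by (intro prod_mono) auto
  also have "\<dots> = exp (\<Sum>i\<in>{j..<n}. q ^ (n - i))" by (simp add: exp_sum)
  also have "(\<Sum>i\<in>{j..<n}. q ^ (n - i)) = (\<Sum>k\<in>(\<lambda>i. n - i) ` {j..<n}. q ^ k)"
    by (subst sum.reindex) (auto simp: inj_on_def)
  also have "\<dots> \<le> (\<Sum>k. q ^ k)"
    using assms by (intro sum_le_suminf summable_geometric) auto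
  also have "\<dots> = 1 / (1 - q)" using assms by (intro suminf_geometric) auto
  finally show ?thesis by simp
qed

text \<open>Downward induction from \<open>n\<close>, with the sharp estimate outside the shadow and
  the lossy factor \<open>C\<close> inside. The sharp estimate applies with relative error
  \<open>q ^ (n - j)\<close>, since c = b + b / 2: with k = n - j, a radius of order exp (- c k)
  equals q^k exp (- b k), and exp (- b k) \<le> |g'|^2 outside the shadow.\<close>

lemma backward_chain_bound:
  fixes g :: "complex poly" and z :: "nat \<Rightarrow> complex" and W :: "nat \<Rightarrow> complex set"
  defines "a \<equiv> \<lambda>j. ln (cmod (poly (pderiv g) (z j)))"
  defines "C \<equiv> (4 * real (degree g)) ^ degree g"
  assumes deg: "degree g > 0"
    and W: "\<And>j. j \<le> n \<Longrightarrow> connected (W j)" "\<And>j. j \<le> n \<Longrightarrow> z j \<in> W j"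
      "\<And>j. j < n \<Longrightarrow> poly g ` W j \<subseteq> W (Suc j)" "W n \<subseteq> ball (z n) \<rho>"
    and z: "\<And>j. z (Suc j) = poly g (z j)" "\<And>j. poly (pderiv g) (z j) \<noteq> 0"
    and M: "M \<ge> 1"
      "\<And>j u. cmod (u - z j) \<le> 1 \<Longrightarrow>
        cmod (poly (pderiv g) u - poly (pderiv g) (z j)) \<le> M * cmod (u - z j)"
      "\<And>j u. cmod (u - z j) \<le> 1 \<Longrightarrow>
        cmod (poly g u - poly g (z j) - poly (pderiv g) (z j) * (u - z j)) \<le> M * cmod (u - z j) ^ 2"
    and b: "b > 0" and c: "c = 3 / 2 * b"
    and hyp: "\<And>j. j < n \<Longrightarrow> c * real (n - j) \<le> sum a {j..<n}"
    and N: "card (shadow a b n) \<le> N"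
    and Q: "Q = C ^ N * exp (1 / (1 - exp (- b / 2)))"
    and \<rho>: "\<rho> > 0" "4 * M * Q * \<rho> * exp c \<le> 1"
  shows "j \<le> n \<Longrightarrow> W j \<subseteq> ball (z j) (Q * \<rho> * exp (- c * real (n - j)))"
    and "\<lbrakk>j < n; j \<notin> shadow a b n\<rbrakk> \<Longrightarrow> W j \<inter> crit_points g = {}"
proof -
  define q where "q = exp (- b / 2)"
  have q: "0 < q" "q < 1" using b by (auto simp: q_def)
  have C1: "C \<ge> 1" unfolding C_def using deg by (intro one_le_power) linarith
  define S where "S = shadow a b n"
  \<comment> \<open>The radius at index \<open>j\<close>: one factor \<open>C\<close> per
    exceptional step, one factor \<open>1 + q ^ (n - i)\<close> per step of either kind, and the
    exact contraction by the derivative.\<close>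
  define B where "B j = C ^ card (S \<inter> {j..<n}) * (\<Prod>i\<in>{j..<n}. 1 + q ^ (n - i)) * \<rho> * exp (- sum a {j..<n})" for j
  have Dexp: "cmod (poly (pderiv g) (z j)) = exp (a j)" for j using z(2) by (simp add: a_def)
  have B0: "B j > 0" for j
    unfolding B_def using C1 q \<rho> by (intro mult_pos_pos prod_pos) (auto intro: add_pos_nonneg)
  have Ble: "B j \<le> Q * \<rho> * exp (- c * real (n - j))" if "j \<le> n" for j
  proof -
    have "card (S \<inter> {j..<n}) \<le> card S" by (intro card_mono) (auto simp: S_def)
    then have "C ^ card (S \<inter> {j..<n}) \<le> C ^ N" using N C1 by (intro power_increasing) (auto simp: S_def)
    moreover have "(\<Prod>i\<in>{j..<n}. 1 + q ^ (n - i)) \<le> exp (1 / (1 - q))"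
      using q by (intro prod_one_plus_geometric_le) auto
    ultimately have "C ^ card (S \<inter> {j..<n}) * (\<Prod>i\<in>{j..<n}. 1 + q ^ (n - i)) \<le> Q"
      unfolding Q q_def[symmetric] using C1 q by (intro mult_mono prod_nonneg) auto
    moreover have "exp (- sum a {j..<n}) \<le> exp (- c * real (n - j))"
      using hyp[of j] that by (cases "j = n") auto
    ultimately show ?thesis unfolding B_def using C1 q \<rho>
      by (intro mult_mono mult_right_mono mult_nonneg_nonneg prod_nonneg) (auto simp: Q)
  qed
  have split: "{j..<n} = insert j {Suc j..<n}" if "j < n" for j using that by auto
  have step: "W j \<subseteq> ball (z j) (B j) \<and> (j \<notin> S \<longrightarrow> W j \<inter> crit_points g = {})"
    if j: "j < n" and IH: "W (Suc j) \<subseteq> ball (z (Suc j)) (B (Suc j))" for j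
  proof -
    have sub: "poly g ` W j \<subseteq> ball (poly g (z j)) (B (Suc j))" using W(3)[OF j] IH z(1) by auto
    have con: "connected (W j)" "z j \<in> W j" using W j by auto
    have Bs: "B j = (if j \<in> S then C else 1) * (1 + q ^ (n - j)) * B (Suc j) / exp (a j)"
      unfolding B_def split[OF j]
      by (simp add: Int_insert_right S_def exp_diff exp_minus field_simps exp_add)
    show ?thesis
    proof (cases "j \<in> S")
      case True
      have "W j \<subseteq> ball (z j) (C * B (Suc j) / exp (a j))"
        using connected_pullback_bound[OF deg con sub z(2)] unfolding C_def Dexp .
      moreover have "C * B (Suc j) / exp (a j) \<le> B j"
      proof -
        have "C * B (Suc j) * 1 \<le> C * B (Suc j) * (1 + q ^ (n - j))"
          using q C1 B0[of "Suc j"] by (intro mult_left_mono) auto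
        then show ?thesis unfolding Bs using True by (simp add: divide_right_mono mult_ac)
      qed
      ultimately show ?thesis using True by force
    next
      case False
      then have ns: "- b * real (n - j) \<le> 2 * a j" using j by (auto simp: S_def shadow_def)
      define k where "k = real (n - j)"
      have k1: "k \<ge> 1" using j by (simp add: k_def)
      \<comment> \<open>The radius is known at \<open>Suc j\<close>, the derivative is taken at
        \<open>j\<close>. This shift costs the factor \<open>exp c\<close> that the smallness
        condition on \<open>\<rho>\<close> provides for.\<close>
      have "n - Suc j = n - j - 1" by simp
      then have "B (Suc j) \<le> Q * \<rho> * exp (c - c * k)"
        using Ble[of "Suc j"] j by (simp add: k_def of_nat_diff algebra_simps)
      then have "4 * M * B (Suc j) \<le> 4 * M * (Q * \<rho> * exp (c - c * k))"
        using M(1) by (intro mult_left_mono) auto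
      also have "\<dots> = (4 * M * Q * \<rho> * exp c) * exp (- c * k)" by (simp add: exp_diff exp_minus field_simps)
      also have "\<dots> \<le> exp (- c * k)" using \<rho>(2) by simp
      finally have B4: "4 * M * B (Suc j) \<le> exp (- c * k)" .
      have qk: "q ^ (n - j) = exp (- b / 2 * k)" by (simp add: q_def k_def exp_of_nat_mult[symmetric])
      have D2: "exp (- b * k) \<le> (exp (a j))\<^sup>2" using ns by (simp add: k_def exp_double[symmetric])
      have "exp (- c * k) = q ^ (n - j) * exp (- b * k)"
        by (simp add: qk c exp_add[symmetric] algebra_simps)
      also have "\<dots> \<le> q ^ (n - j) * (exp (a j))\<^sup>2" using D2 q by (intro mult_left_mono) auto
      finally have e1: "4 * M * B (Suc j) \<le> q ^ (n - j) * (exp (a j))\<^sup>2" using B4 by linarith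
      have e2: "q ^ (n - j) \<le> 1" using q by (simp add: power_le_one)
      have "2 * B (Suc j) \<le> 4 * M * B (Suc j)" using M(1) B0[of "Suc j"] by (intro mult_right_mono) auto
      also have "\<dots> \<le> exp (- c * k)" by (rule B4)
      \<comment> \<open>Outside the shadow a_j \<ge> - b k / 2, while c k = 3 b k / 2.\<close>
      also have "\<dots> \<le> exp (a j)"
      proof -
        have "b * k \<ge> 0" using b k1 by simp
        then show ?thesis using ns by (simp add: c k_def)
      qed
      finally have e3: "2 * B (Suc j) \<le> exp (a j)" .
      have M0: "M > 0" using M(1) by simp
      note res = connected_pullback_bound_noncritical[OF con sub Dexp[symmetric] exp_gt_zero M0 M(2) M(3) e1 e2 e3]
      show ?thesis using res Bs False by simp
    qed
  qed
  have bound: "W j \<subseteq> ball (z j) (B j)" if "j \<le> n" for j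
    using that
  proof (induction rule: inc_induct)
    case base
    then show ?case using W(4) by (simp add: B_def)
  next
    case (step j)
    then show ?case using \<open>\<And>j. j < n \<Longrightarrow> W (Suc j) \<subseteq> _ \<Longrightarrow> _\<close> by blast
  qed
  show "W j \<subseteq> ball (z j) (Q * \<rho> * exp (- c * real (n - j)))" if "j \<le> n"
    using bound[OF that] Ble[OF that] by force
  show "W j \<inter> crit_points g = {}" if "j < n" "j \<notin> shadow a b n"
    using step[OF that(1) bound] that by (auto simp: S_def)
qed

section \<open>Iterates and boundedness of orbits in the Julia set\<close>

lemma iter_0 [simp]: "iter g 0 z = z" by (simp add: iter_def)

lemma iter_Suc [simp]: "iter g (Suc n) z = poly g (iter g n z)" by (simp add: iter_def)

lemma continuous_on_iter: "continuous_on S (iter g n)"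
proof (induction n)
  case (Suc n)
  have "iter g (Suc n) = (\<lambda>z. poly g (iter g n z))" by auto
  then show ?case using Suc by (auto intro!: continuous_intros)
qed (simp add: iter_def)

lemma deriv_iter: "deriv (iter g n) z = (\<Prod>j<n. poly (pderiv g) (iter g j z))"
proof -
  have "(iter g n has_field_derivative (\<Prod>j<n. poly (pderiv g) (iter g j z))) (at z)"
  proof (induction n)
    case (Suc n)
    have "iter g (Suc n) = (\<lambda>z. poly g (iter g n z))" by auto
    then show ?case using DERIV_chain2[OF poly_DERIV Suc] by (simp add: mult.commute)
  qed (simp add: iter_def)
  then show ?thesis by (rule DERIV_imp_deriv)
qed

lemma poly_escape_radius:
  fixes g :: "complex poly"
  assumes "degree g \<ge> 2"
  obtains R where "R \<ge> 1" "\<And>z. cmod z > R \<Longrightarrow> cmod (poly g z) \<ge> 2 * cmod z"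
proof -
  obtain a p where g: "g = pCons a p" by (cases g)
  obtain b p' where p: "p = pCons b p'" by (cases p)
  \<comment> \<open>g(z) = a + z p(z) with \<open>p\<close> nonconstant, so |p| \<ge> 3 far out. One
    of the three multiples of |z| pays for the constant term a.\<close>
  have "p' \<noteq> 0" using assms by (auto simp: g p split: if_splits)
  then obtain r where r: "\<And>z. r \<le> cmod z \<Longrightarrow> 3 \<le> cmod (poly p z)"
    using poly_infinity[of p' 3 b] unfolding p by auto
  show ?thesis
  proof (rule that[of "max 1 (max r (cmod a))"])
    fix z assume z: "max 1 (max r (cmod a)) < cmod z"
    have "cmod z * 3 \<le> cmod z * cmod (poly p z)" using r z by (intro mult_left_mono) auto
    also have "\<dots> \<le> cmod (poly g z) + cmod a"
      using norm_triangle_ineq4[of "poly g z" a] by (simp add: g norm_mult)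
    finally show "2 * cmod z \<le> cmod (poly g z)" using z by simp
  qed simp
qed

text \<open>An orbit that leaves the disk of radius R at least doubles its modulus at every later
  step. So for each \<open>j\<close> the filled Julia set lies in the preimage of the closed disk
  under g^j; this preimage is closed and hence contains the frontier as well.\<close>

lemma julia_orbit_bounded:
  fixes g :: "complex poly"
  assumes "degree g \<ge> 2"
  obtains R where "\<And>z j. z \<in> julia_set g \<Longrightarrow> cmod (iter g j z) \<le> R"
proof -
  obtain R where R: "R \<ge> 1" "\<And>z. cmod z > R \<Longrightarrow> cmod (poly g z) \<ge> 2 * cmod z"
    using poly_escape_radius[OF assms] by blast
  have "cmod (iter g j z) \<le> R" if z: "z \<in> filled_julia g" for z j
  proof (rule ccontr)
    assume "\<not> ?thesis"
    then have gt: "cmod (iter g j z) > R" by simp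
    have grow: "2 ^ k < cmod (iter g (k + j) z) \<and> R < cmod (iter g (k + j) z)" for k
    proof (induction k)
      case 0
      then show ?case using gt R(1) by simp
    next
      case (Suc k)
      then show ?case using R(2)[of "iter g (k + j) z"] R(1) by simp
    qed
    obtain B where B: "\<And>n. cmod (iter g n z) \<le> B"
      using z by (auto simp: filled_julia_def bounded_iff)
    obtain k where "B < 2 ^ k" using real_arch_pow[of 2 B] by auto
    with grow[of k] B[of "k + j"] show False by linarith
  qed
  then have "filled_julia g \<subseteq> iter g j -` cball 0 R" for j by auto
  moreover have "closed (iter g j -` cball 0 R)" for j
    using continuous_on_iter[of UNIV g j] by (intro closed_vimage) auto
  ultimately have "closure (filled_julia g) \<subseteq> iter g j -` cball 0 R" for j by (metis closure_minimal)
  then have "cmod (iter g j z) \<le> R" if "z \<in> julia_set g" for z j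
    using that by (fastforce simp: julia_set_def frontier_def)
  then show ?thesis using that by blast
qed

section \<open>Pullback components at good times\<close>

lemma pullback_comp_subset: "pullback_comp g n \<rho> z \<subseteq> iter g n -` ball (iter g n z) \<rho>"
  unfolding pullback_comp_def by (rule connected_component_subset)

text \<open>The images of the component under g^0, ..., g^n form a chain to which
  \<open>backward_chain_bound\<close> applies. Indices whose image meets the critical set lie in the
  shadow, which has at most \<open>N\<close> elements. The estimates are assumed on radius
  \<open>R + 1\<close> so that they cover unit disks about the orbit points.\<close>

lemma pullback_comp_good_time:
  fixes g :: "complex poly" and z0 :: complex
  defines "a \<equiv> \<lambda>j. ln (cmod (poly (pderiv g) (iter g j z0)))"
  defines "C \<equiv> (4 * real (degree g)) ^ degree g"
  assumes deg: "degree g > 0"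
    and z: "\<And>j. poly (pderiv g) (iter g j z0) \<noteq> 0" "\<And>j. cmod (iter g j z0) \<le> R"
    and M: "M \<ge> 1"
      "\<And>w u. \<lbrakk>cmod w \<le> R + 1; cmod u \<le> R + 1\<rbrakk> \<Longrightarrow>
        cmod (poly (pderiv g) u - poly (pderiv g) w) \<le> M * cmod (u - w)"
      "\<And>w u. \<lbrakk>cmod w \<le> R + 1; cmod u \<le> R + 1\<rbrakk> \<Longrightarrow>
        cmod (poly g u - poly g w - poly (pderiv g) w * (u - w)) \<le> M * cmod (u - w) ^ 2"
    and b: "b > 0" and c: "c = 3 / 2 * b"
    and hyp: "\<And>j. j < n \<Longrightarrow> c * real (n - j) \<le> sum a {j..<n}"
    and N: "card (shadow a b n) \<le> N"
    and Q: "Q = C ^ N * exp (1 / (1 - exp (- b / 2)))"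
    and \<rho>: "\<rho> > 0" "4 * M * Q * \<rho> * exp c \<le> 1"
  shows "pullback_comp g n \<rho> z0 \<subseteq> ball z0 (Q * \<rho> * exp (- c * real n))"
    and "at_most_critical g n (pullback_comp g n \<rho> z0) N"
proof -
  define V where "V = pullback_comp g n \<rho> z0"
  have V: "connected V" "z0 \<in> V" "iter g n ` V \<subseteq> ball (iter g n z0) \<rho>"
    using pullback_comp_subset[of g n \<rho> z0] \<rho>(1)
    by (auto simp: V_def pullback_comp_def connected_component_refl_eq)
  have near: "cmod u \<le> R + 1" "cmod (iter g j z0) \<le> R + 1" if "cmod (u - iter g j z0) \<le> 1" for u j
    using that z(2)[of j] norm_triangle_ineq2[of u "iter g j z0"] by linarith+
  note res = backward_chain_bound[where z = "\<lambda>j. iter g j z0" and W = "\<lambda>j. iter g j ` V" and g = g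
      and n = n and \<rho> = \<rho> and M = M and b = b and c = c and N = N and Q = Q,
      folded a_def C_def, OF deg]
  have con: "connected (iter g j ` V)" for j
    by (intro connected_continuous_image continuous_on_iter V)
  have "iter g 0 ` V \<subseteq> ball (iter g 0 z0) (Q * \<rho> * exp (- c * real (n - 0)))"
    by (rule res(1)) (use con V z M near b c hyp N Q \<rho> in auto)
  then show "pullback_comp g n \<rho> z0 \<subseteq> ball z0 (Q * \<rho> * exp (- c * real n))" by (simp add: V_def)
  have nc: "iter g j ` V \<inter> crit_points g = {}" if "j < n" "j \<notin> shadow a b n" for j
    by (rule res(2)) (use con V z M near b c hyp N Q \<rho> that in auto)
  have "card {j. j < n \<and> iter g j ` V \<inter> crit_points g \<noteq> {}} \<le> card (shadow a b n)"
    using nc by (intro card_mono) auto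
  then show "at_most_critical g n (pullback_comp g n \<rho> z0) N"
    using N by (simp add: at_most_critical_def V_def)
qed

lemma upper_lyapunov_frequently:
  assumes "upper_lyapunov g z > ereal x"
  shows "\<exists>\<^sub>F m in sequentially. (\<forall>j<m. poly (pderiv g) (iter g j z) \<noteq> 0) \<and>
    x * real m \<le> (\<Sum>j<m. ln (cmod (poly (pderiv g) (iter g j z))))"
proof -
  have "\<exists>\<^sub>F m in sequentially. ereal x < lyap_term g z m"
  proof (rule ccontr)
    assume "\<not> ?thesis"
    then have "\<forall>\<^sub>F m in sequentially. lyap_term g z m \<le> ereal x" by (simp add: frequently_def not_less)
    then have "limsup (lyap_term g z) \<le> ereal x" by (rule Limsup_bounded)
    with assms show False by (simp add: upper_lyapunov_def)
  qed
  moreover have "\<forall>\<^sub>F m in sequentially. m > 0" by (rule eventually_gt_at_top)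
  ultimately have "\<exists>\<^sub>F m in sequentially. ereal x < lyap_term g z m \<and> m > 0"
    by (rule frequently_eventually_frequently)
  then show ?thesis
  proof (rule frequently_elim1)
    fix m assume m: "ereal x < lyap_term g z m \<and> m > 0"
    \<comment> \<open>A vanishing derivative would make \<open>lyap_term\<close> equal to -
      \<infinity>. By the chain rule no factor of the product vanishes either.\<close>
    then have nz: "deriv (iter g m) z \<noteq> 0" by (auto simp: lyap_term_def)
    then have nz': "\<forall>j<m. poly (pderiv g) (iter g j z) \<noteq> 0" by (simp add: deriv_iter)
    have "x * real m \<le> ln (cmod (deriv (iter g m) z))"
      using conjunct1[OF m] conjunct2[OF m] nz by (simp add: lyap_term_def pos_less_divide_eq)
    also have "\<dots> = (\<Sum>j<m. ln (cmod (poly (pderiv g) (iter g j z))))"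
      unfolding deriv_iter by (subst prod_norm[symmetric], rule Transcendental.ln_prod) (use nz' in auto)
    finally show "(\<forall>j<m. poly (pderiv g) (iter g j z) \<noteq> 0) \<and>
      x * real m \<le> (\<Sum>j<m. ln (cmod (poly (pderiv g) (iter g j z))))" using nz' by simp
  qed
qed

section \<open>Choice of constants and conclusion\<close>

theorem theorem1p5:
  fixes g :: "complex poly"
  assumes "degree g \<ge> 2"
  shows "\<forall>lam::real. lam > 1 \<longrightarrow>
    (\<exists>\<rho>::real. \<rho> > 0 \<and> (\<exists>N::nat. N > 0 \<and> (\<exists>\<alpha>::real. \<alpha> > 0 \<and>
      (\<forall>z \<in> julia_set g. upper_lyapunov g z > ereal (2 * ln lam) \<longrightarrow>
        (\<exists>H::nat set. 0 \<notin> H \<and> upper_density H \<ge> ereal \<alpha> \<and>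
           (\<forall>n\<in>H. pullback_comp g n \<rho> z \<subseteq> ball z (\<rho> / lam ^ n) \<and>
                   at_most_critical g n (pullback_comp g n \<rho> z) N))))))"
proof (intro allI impI)
  fix lam :: real assume lam: "lam > 1"
  define b where "b = ln lam"
  define c where "c = 3 / 2 * b"
  have b: "b > 0" "b < c" "c < 2 * b" using lam by (auto simp: b_def c_def)
  have deg: "degree g > 0" using assms by simp
  obtain R where R: "\<And>z j. z \<in> julia_set g \<Longrightarrow> cmod (iter g j z) \<le> R"
    using julia_orbit_bounded[OF assms] by blast
  obtain M where M: "M \<ge> 1"
    "\<And>w. cmod w \<le> R + 1 \<Longrightarrow> cmod (poly (pderiv g) w) \<le> M"
    "\<And>w u. \<lbrakk>cmod w \<le> R + 1; cmod u \<le> R + 1\<rbrakk> \<Longrightarrow>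
      cmod (poly (pderiv g) u - poly (pderiv g) w) \<le> M * cmod (u - w)"
    "\<And>w u. \<lbrakk>cmod w \<le> R + 1; cmod u \<le> R + 1\<rbrakk> \<Longrightarrow>
      cmod (poly g u - poly g w - poly (pderiv g) w * (u - w)) \<le> M * cmod (u - w) ^ 2"
    using poly_taylor_bound[of "R + 1" g] by blast
  \<comment> \<open>\<open>ln M\<close> bounds the a_j from above; \<open>2 * b\<close> ensures
    \<open>A > c\<close>. All constants below are independent of \<open>z\<close>.\<close>
  define A where "A = max (2 * b) (ln M)"
  have Ac: "A - c > 0" using b by (simp add: A_def)
  define N where "N = Suc (nat \<lceil>4 * A * (A - c) / (b * (2 * b - c))\<rceil>)"
  have "4 * A * (A - c) / (b * (2 * b - c)) \<le> real N" unfolding N_def by linarith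
  then have N: "4 * A * (A - c) \<le> b * (2 * b - c) * real N" using b by (simp add: pos_divide_le_eq mult_ac)
  define Q where "Q = ((4 * real (degree g)) ^ degree g) ^ N * exp (1 / (1 - exp (- b / 2)))"
  have Q0: "Q > 0" using deg by (simp add: Q_def)
  define \<rho> where "\<rho> = 1 / (4 * M * Q * exp c)"
  have \<rho>: "\<rho> > 0" "4 * M * Q * \<rho> * exp c \<le> 1" using M(1) Q0 by (auto simp: \<rho>_def)
  define \<theta> where "\<theta> = (2 * b - c) / (2 * (A - c))"
  have th: "\<theta> > 0" using b Ac by (simp add: \<theta>_def)
  \<comment> \<open>From \<open>n0\<close> on, the surplus exp (- (c - b) n) = exp (- b n / 2)
    absorbs \<open>Q\<close>. The \<open>Suc\<close> keeps 0 out of \<open>H\<close>.\<close>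
  define n0 where "n0 = Suc (nat \<lceil>2 * ln Q / b\<rceil>)"
  have n0: "Q * exp (- c * real n) \<le> 1 / lam ^ n" if "n \<ge> n0" for n
  proof -
    have "2 * ln Q / b \<le> real n" using that unfolding n0_def by linarith
    then have "ln Q \<le> b / 2 * real n" using b by (simp add: field_simps)
    then have "Q \<le> exp (b / 2 * real n)" using Q0 by (metis exp_le_cancel_iff exp_ln)
    then have "Q * exp (- c * real n) \<le> exp (b / 2 * real n) * exp (- c * real n)"
      by (intro mult_right_mono) auto
    also have "\<dots> = exp (- (real n * b))" by (simp add: c_def exp_add[symmetric] algebra_simps)
    also have "\<dots> = 1 / lam ^ n" using lam by (simp add: b_def exp_minus exp_of_nat_mult inverse_eq_divide)
    finally show ?thesis .
  qed
  have main: "\<exists>H::nat set. 0 \<notin> H \<and> upper_density H \<ge> ereal (\<theta> / 2) \<and>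
           (\<forall>n\<in>H. pullback_comp g n \<rho> z \<subseteq> ball z (\<rho> / lam ^ n) \<and>
                   at_most_critical g n (pullback_comp g n \<rho> z) N)"
    if z: "z \<in> julia_set g" and chi: "upper_lyapunov g z > ereal (2 * ln lam)" for z
  proof -
    define a where "a j = ln (cmod (poly (pderiv g) (iter g j z)))" for j
    have freq: "\<exists>\<^sub>F m in sequentially. (\<forall>j<m. poly (pderiv g) (iter g j z) \<noteq> 0) \<and> 2 * b * real m \<le> sum a {..<m}"
      using upper_lyapunov_frequently[OF chi] by (simp add: a_def b_def)
    \<comment> \<open>The derivative of g^m at \<open>z\<close> is nonzero for arbitrarily large m,
      so the orbit never hits a critical point.\<close>
    have nz: "poly (pderiv g) (iter g j z) \<noteq> 0" for j
    proof -
      have "\<exists>m>j. \<forall>i<m. poly (pderiv g) (iter g i z) \<noteq> 0"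
        using freq by (auto simp: frequently_sequentially) (metis Suc_le_lessD)
      then show ?thesis by blast
    qed
    have aA: "a j \<le> A" for j
    proof -
      have "cmod (poly (pderiv g) (iter g j z)) \<le> M" using M(2) R[OF z, of j] by simp
      then have "a j \<le> ln M" unfolding a_def using nz M(1) by (subst ln_le_cancel_iff) auto
      then show ?thesis by (simp add: A_def)
    qed
    define H where "H = {n. n \<ge> n0 \<and> (\<forall>j<n. c * real (n - j) \<le> sum a {j..<n}) \<and> card (shadow a b n) \<le> N}"
    have "\<exists>\<^sub>F m in sequentially. \<theta> / 2 * real m \<le> real (card (H \<inter> {1..m}))"
    proof -
      \<comment> \<open>For such \<open>m\<close> the discarded \<open>n0\<close> times cost at most
        half of \<open>\<theta> * m\<close>, which gives the density
        \<open>\<theta> / 2\<close>.\<close>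
      have "\<forall>\<^sub>F m in sequentially. real m \<ge> 2 * real n0 / \<theta>"
        using filterlim_real_sequentially by (simp add: filterlim_at_top)
      then have "\<exists>\<^sub>F m in sequentially. ((\<forall>j<m. poly (pderiv g) (iter g j z) \<noteq> 0) \<and> 2 * b * real m \<le> sum a {..<m})
          \<and> real m \<ge> 2 * real n0 / \<theta>"
        using freq frequently_eventually_frequently by blast
      then show ?thesis
      proof (rule frequently_elim1, elim conjE)
        fix m assume m: "2 * b * real m \<le> sum a {..<m}" "real m \<ge> 2 * real n0 / \<theta>"
        have "\<theta> * real m - real n0 \<le> real (card (H \<inter> {1..m}))"
          unfolding H_def \<theta>_def by (rule card_good_times[OF aA b _ N m(1)]) (simp add: A_def)
        moreover have "real n0 \<le> \<theta> / 2 * real m" using m(2) th by (simp add: field_simps)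
        ultimately show "\<theta> / 2 * real m \<le> real (card (H \<inter> {1..m}))" by simp
      qed
    qed
    then have dens: "upper_density H \<ge> ereal (\<theta> / 2)" by (rule upper_density_ge)
    have "pullback_comp g n \<rho> z \<subseteq> ball z (\<rho> / lam ^ n) \<and> at_most_critical g n (pullback_comp g n \<rho> z) N"
      if n: "n \<in> H" for n
    proof -
      have hyp: "\<And>j. j < n \<Longrightarrow> c * real (n - j) \<le> sum a {j..<n}" and sh: "card (shadow a b n) \<le> N"
        and nn: "n0 \<le> n" using n by (auto simp: H_def)
      note res = pullback_comp_good_time[OF deg nz R[OF z] M(1,3,4) b(1) c_def
          hyp[unfolded a_def] sh[unfolded a_def] Q_def \<rho>]
      have "\<rho> * (Q * exp (- c * real n)) \<le> \<rho> * (1 / lam ^ n)"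
        using n0[OF nn] \<rho>(1) by (intro mult_left_mono) auto
      then have "ball z (Q * \<rho> * exp (- c * real n)) \<subseteq> ball z (\<rho> / lam ^ n)"
        by (intro subset_ball) (simp add: algebra_simps)
      then show ?thesis using res by blast
    qed
    moreover have "0 \<notin> H" by (auto simp: H_def n0_def)
    ultimately show ?thesis using dens by blast
  qed
  have "N > 0" "\<theta> / 2 > 0" using th by (auto simp: N_def)
  then show "\<exists>\<rho>::real. \<rho> > 0 \<and> (\<exists>N::nat. N > 0 \<and> (\<exists>\<alpha>::real. \<alpha> > 0 \<and>
      (\<forall>z \<in> julia_set g. upper_lyapunov g z > ereal (2 * ln lam) \<longrightarrow>
        (\<exists>H::nat set. 0 \<notin> H \<and> upper_density H \<ge> ereal \<alpha> \<and>
           (\<forall>n\<in>H. pullback_comp g n \<rho> z \<subseteq> ball z (\<rho> / lam ^ n) \<and>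
                   at_most_critical g n (pullback_comp g n \<rho> z) N)))))"
    using main \<rho>(1) by blast
qed

end
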